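(* Let $\nu$ be a submodular normalized capacity on $[0,1]$, with dual capacity $\overline{\nu}$, satisfying $\nu(A)\le c\cdot\overline{\nu}(A)$ for all $A$ in its domain, where $c\ge 1$ is a constant, and such that $\nu([k/(n+1),(k+1)/(n+1)])>0$ for all $n\in\mathbb{N}$ and $0\le k\le n$. Let $(K_{n,\nu})_{n}$ be the associated Bernstein-Kantorovich-Choquet operators on $C([0,1])$. Then for every nonnegative function $f\in C([0,1])$, every $x\in[0,1]$ and every $n\in\mathbb{N}$, \[ |K_{n,\nu}(f)(x)-f(x)|\le (c+1)\,\omega_{1}\!\left(f;\sqrt{x^{2}+2x\,K_{n,\nu}(-t)(x)+K_{n,\nu}(t^{2})(x)}\right), \] where $K_{n,\nu}(-t)$ and $K_{n,\nu}(t^2)$ denote $K_{n,\nu}$ applied to the functions $t\mapsto -t$ and $t\mapsto t^{2}$ respectively, and \[ \omega_{1}(f;\delta)=\sup\{|f(t)-f(s)|: t,s\in[0,1],\ |t-s|\le\delta\} \] is the modulus of continuity of $f$.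
   Context: Let $\Sigma$ be an algebra of subsets of $[0,1]$ containing all closed subsets of $[0,1]$ (so that all continuous functions are upper measurable, i.e. all sets $\{x:f(x)\ge t\}$ belong to $\Sigma$). A capacity on $\Sigma$ is a set function $\nu:\Sigma\to[0,\infty)$ with $\nu(\emptyset)=0$ and $\nu(A)\le\nu(B)$ whenever $A\subset B$ in $\Sigma$. It is normalized if $\nu([0,1])=1$. It is submodular if $\nu(A\cup B)+\nu(A\cap B)\le\nu(A)+\nu(B)$ for all $A,B\in\Sigma$. Its dual is the capacity $\overline{\nu}(A)=\nu([0,1])-\nu([0,1]\setminus A)$, $A\in\Sigma$. The Choquet integral of an upper measurable bounded function $f$ on a set $A\in\Sigma$ is \[ (C)\int_{A}f\,\mathrm{d}\nu=\int_{0}^{+\infty}\nu(\{x\in A:f(x)\ge t\})\,\mathrm{d}t+\int_{-\infty}^{0}\left[\nu(\{x\in A:f(x)\ge t\})-\nu(A)\right]\mathrm{d}t . \] For $n\in\mathbb{N}=\{1,2,\dots\}$, the Bernstein-Kantorovich-Choquet operator $K_{n,\nu}:C([0,1])\to C([0,1])$ is \[ K_{n,\nu}(f)(x)=\sum_{k=0}^{n}\frac{(C)\int_{[k/(n+1),(k+1)/(n+1)]}f(t)\,\mathrm{d}\nu(t)}{\nu([k/(n+1),(k+1)/(n+1)])}\binom{n}{k}x^{k}(1-x)^{n-k}. \] *)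

theory Defs
  imports "HOL-Analysis.Analysis"
begin

definition closed_containing_algebra :: "real set set \<Rightarrow> bool" where
  "closed_containing_algebra \<Sigma> \<longleftrightarrow>
     algebra {0..1} \<Sigma> \<and> (\<forall>C. closed C \<longrightarrow> C \<subseteq> {0..1} \<longrightarrow> C \<in> \<Sigma>)"

definition capacity :: "real set set \<Rightarrow> (real set \<Rightarrow> real) \<Rightarrow> bool" where
  "capacity \<Sigma> \<nu> \<longleftrightarrow>
     \<nu> {} = 0 \<and> (\<forall>A\<in>\<Sigma>. 0 \<le> \<nu> A) \<and>
     (\<forall>A\<in>\<Sigma>. \<forall>B\<in>\<Sigma>. A \<subseteq> B \<longrightarrow> \<nu> A \<le> \<nu> B)"

definition normalized :: "(real set \<Rightarrow> real) \<Rightarrow> bool" where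
  "normalized \<nu> \<longleftrightarrow> \<nu> {0..1} = 1"

definition submodular :: "real set set \<Rightarrow> (real set \<Rightarrow> real) \<Rightarrow> bool" where
  "submodular \<Sigma> \<nu> \<longleftrightarrow>
     (\<forall>A\<in>\<Sigma>. \<forall>B\<in>\<Sigma>. \<nu> (A \<union> B) + \<nu> (A \<inter> B) \<le> \<nu> A + \<nu> B)"

definition dual_capacity :: "(real set \<Rightarrow> real) \<Rightarrow> real set \<Rightarrow> real" where
  "dual_capacity \<nu> A = \<nu> {0..1} - \<nu> ({0..1} - A)"

text \<open>For a bounded upper measurable \<open>f\<close> both integrands are monotone, bounded and of bounded
  support on the half-line, so the Henstock--Kurzweil integrals below exist and agree with the
  improper Riemann integrals.\<close>

definition choquet_integral :: "(real set \<Rightarrow> real) \<Rightarrow> real set \<Rightarrow> (real \<Rightarrow> real) \<Rightarrow> real" where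
  "choquet_integral \<nu> A f =
     integral {0..} (\<lambda>t. \<nu> {x\<in>A. f x \<ge> t}) +
     integral {..0} (\<lambda>t. \<nu> {x\<in>A. f x \<ge> t} - \<nu> A)"

definition kantorovich_interval :: "nat \<Rightarrow> nat \<Rightarrow> real set" where
  "kantorovich_interval n k = {real k / real (n + 1) .. real (k + 1) / real (n + 1)}"

text \<open>Elements of \<open>C([0,1])\<close> are represented by functions on \<open>real\<close> that are continuous on
  \<open>{0..1}\<close>; for \<open>k \<le> n\<close> only values on \<open>{0..1}\<close> enter the operator.\<close>

definition bernstein_kantorovich_choquet ::
    "nat \<Rightarrow> (real set \<Rightarrow> real) \<Rightarrow> (real \<Rightarrow> real) \<Rightarrow> real \<Rightarrow> real" where
  "bernstein_kantorovich_choquet n \<nu> f x =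
     (\<Sum>k=0..n. choquet_integral \<nu> (kantorovich_interval n k) f / \<nu> (kantorovich_interval n k)
        * real (n choose k) * x ^ k * (1 - x) ^ (n - k))"

definition modulus_of_continuity :: "(real \<Rightarrow> real) \<Rightarrow> real \<Rightarrow> real" where
  "modulus_of_continuity f \<delta> =
     Sup {\<bar>f t - f s\<bar> | t s. t \<in> {0..1} \<and> s \<in> {0..1} \<and> \<bar>t - s\<bar> \<le> \<delta>}"

end

(* For submodular \<nu> the Choquet integral is subadditive on continuous functions.  For integer-valued
   functions this is a rearrangement of level sets by submodularity; rounding a nonnegative f down to an
   integer costs a bounded error, which homogeneity makes arbitrarily small.  Hence L f = K_n f (x) is
   a monotone, translation invariant, sublinear functional, so that |L f - f x| <= L |f - f x| and
   L ((t - x)^2) <= D, the expression under the square root.  Applying L to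
   |f t - f x| <= omega(delta) (1 + (t - x)^2 / delta^2) with delta = sqrt D gives the factor
   2 <= c + 1; if D = 0, let delta tend to 0 instead. *)

theory Submission
  imports Defs
begin

subsection \<open>The modulus of continuity\<close>

text \<open>A real \<open>Sup\<close> dominates its set only if the set is bounded above;
  compactness of [0,1] supplies the bound.\<close>

lemma modulus_of_continuity_upper:
  assumes "continuous_on {0..1} f" "s \<in> {0..1}" "t \<in> {0..1}" "\<bar>t - s\<bar> \<le> \<delta>"
  shows "\<bar>f t - f s\<bar> \<le> modulus_of_continuity f \<delta>"
  unfolding modulus_of_continuity_def
proof (rule cSup_upper)
  have "compact (f ` {0..1})"
    using assms(1) by (intro compact_continuous_image) auto
  then obtain B where B: "\<And>t. t \<in> {0..1} \<Longrightarrow> \<bar>f t\<bar> \<le> B"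
    using compact_imp_bounded bounded_iff by (metis image_eqI real_norm_def)
  show "bdd_above {\<bar>f t - f s\<bar> |t s. t \<in> {0..1} \<and> s \<in> {0..1} \<and> \<bar>t - s\<bar> \<le> \<delta>}"
  proof (rule bdd_aboveI, clarify)
    fix t s :: real assume "t \<in> {0..1}" "s \<in> {0..1}"
    then show "\<bar>f t - f s\<bar> \<le> 2 * B"
      using B[of t] B[of s] by linarith
  qed
qed (use assms in blast)

lemma modulus_of_continuity_nonneg:
  assumes "continuous_on {0..1} f" "0 \<le> \<delta>"
  shows "0 \<le> modulus_of_continuity f \<delta>"
  using modulus_of_continuity_upper[OF assms(1), of 0 0 \<delta>] assms(2) by simp

lemma modulus_of_continuity_small:
  assumes "continuous_on {0..1} f" "0 < e"
  obtains d where "0 < d" "modulus_of_continuity f d \<le> e"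
proof -
  have "uniformly_continuous_on {0..1} f"
    using assms(1) by (intro compact_uniformly_continuous) auto
  then obtain d where d: "0 < d"
    "\<And>s t. s \<in> {0..1} \<Longrightarrow> t \<in> {0..1} \<Longrightarrow> \<bar>t - s\<bar> < d \<Longrightarrow> \<bar>f t - f s\<bar> < e"
    using assms(2) unfolding uniformly_continuous_on_def dist_real_def by metis
  \<comment> \<open>Halving \<open>d\<close> turns the strict distance condition of uniform
    continuity into the non-strict one in the modulus.\<close>
  have "modulus_of_continuity f (d / 2) \<le> e"
    unfolding modulus_of_continuity_def
  proof (rule cSup_least)
    have "\<bar>f 0 - f 0\<bar> \<in> {\<bar>f t - f s\<bar> |t s. t \<in> {0..1} \<and> s \<in> {0..1} \<and> \<bar>t - s\<bar> \<le> d / 2}"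
      using d(1) by force
    then show "{\<bar>f t - f s\<bar> |t s. t \<in> {0..1} \<and> s \<in> {0..1} \<and> \<bar>t - s\<bar> \<le> d / 2} \<noteq> {}"
      by blast
    fix y assume "y \<in> {\<bar>f t - f s\<bar> |t s. t \<in> {0..1} \<and> s \<in> {0..1} \<and> \<bar>t - s\<bar> \<le> d / 2}"
    then obtain t s where "y = \<bar>f t - f s\<bar>" "t \<in> {0..1}" "s \<in> {0..1}" "\<bar>t - s\<bar> \<le> d / 2"
      by blast
    then show "y \<le> e"
      using d(2)[of s t] d(1) by force
  qed
  with d(1) show ?thesis
    using that[of "d / 2"] by simp
qed

text \<open>Cut the segment from \<open>s\<close> to \<open>t\<close> into \<open>N\<close> equal
  steps, each no longer than \<open>\<delta>\<close>, and add up the increments of \<open>f\<close>.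
  The induction peels off the step nearest to \<open>t\<close>.\<close>

lemma modulus_of_continuity_multiple:
  assumes "continuous_on {0..1} f" "s \<in> {0..1}" "t \<in> {0..1}" "\<bar>t - s\<bar> \<le> real N * \<delta>"
  shows "\<bar>f t - f s\<bar> \<le> real N * modulus_of_continuity f \<delta>"
  using assms(3,4)
proof (induction N arbitrary: t)
  case 0
  then show ?case by simp
next
  case (Suc N)
  \<comment> \<open>\<open>u\<close> below is the last division point before \<open>t\<close>:
    \<open>N\<close> steps lie between \<open>s\<close> and \<open>u\<close>, and one between
    \<open>u\<close> and \<open>t\<close>.\<close>
  define \<theta> where "\<theta> = real N / real (Suc N)"
  have \<theta>: "0 \<le> \<theta>" "\<theta> \<le> 1" "1 - \<theta> = 1 / real (Suc N)"
    by (auto simp: \<theta>_def field_simps)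
  define u where "u = (1 - \<theta>) * s + \<theta> * t"
  have us: "u - s = \<theta> * (t - s)" and tu: "t - u = (1 - \<theta>) * (t - s)"
    by (auto simp: u_def algebra_simps)
  have "u \<in> {0..1}"
    using convexD_alt[of "{0..1::real}" s t \<theta>] assms(2) Suc.prems(1) \<theta> by (simp add: u_def)
  moreover have "\<bar>u - s\<bar> \<le> real N * \<delta>"
  proof -
    have "\<bar>u - s\<bar> \<le> \<theta> * (real (Suc N) * \<delta>)"
      unfolding us abs_mult using \<theta>(1) Suc.prems(2) by (simp add: mult_left_mono del: of_nat_Suc)
    then show ?thesis by (simp add: \<theta>_def del: of_nat_Suc)
  qed
  ultimately have 1: "\<bar>f u - f s\<bar> \<le> real N * modulus_of_continuity f \<delta>"
    by (rule Suc.IH)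
  have "\<bar>t - u\<bar> \<le> (1 - \<theta>) * (real (Suc N) * \<delta>)"
    unfolding tu abs_mult using \<theta>(2) Suc.prems(2) by (simp add: mult_left_mono del: of_nat_Suc)
  then have "\<bar>t - u\<bar> \<le> \<delta>"
    by (simp add: \<theta>(3) del: of_nat_Suc)
  then have 2: "\<bar>f t - f u\<bar> \<le> modulus_of_continuity f \<delta>"
    using \<open>u \<in> {0..1}\<close> Suc.prems(1) assms(1) by (intro modulus_of_continuity_upper)
  show ?case
    using 1 2 by (simp add: algebra_simps)
qed

text \<open>With \<open>r\<close> the distance in units of \<open>\<delta>\<close>, the number of
  steps is at most \<open>1 + r\<close>, hence at most \<open>1 + r^2\<close> once
  \<open>r \<ge> 1\<close>. The square is wanted because a positive functional then only has to be
  controlled on its second moment.\<close>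

lemma modulus_of_continuity_quadratic:
  assumes "continuous_on {0..1} f" "s \<in> {0..1}" "t \<in> {0..1}" "0 < \<delta>"
  shows "\<bar>f t - f s\<bar> \<le> modulus_of_continuity f \<delta> * (1 + (t - s)\<^sup>2 / \<delta>\<^sup>2)"
proof (cases "\<bar>t - s\<bar> \<le> \<delta>")
  case True
  have "\<bar>f t - f s\<bar> \<le> modulus_of_continuity f \<delta> * 1"
    using modulus_of_continuity_upper[OF assms(1-3) True] by simp
  also have "\<dots> \<le> modulus_of_continuity f \<delta> * (1 + (t - s)\<^sup>2 / \<delta>\<^sup>2)"
    using modulus_of_continuity_nonneg[OF assms(1), of \<delta>] assms(4)
    by (intro mult_left_mono) auto
  finally show ?thesis .
next
  case False
  define r where "r = \<bar>t - s\<bar> / \<delta>"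
  have r: "1 \<le> r" "r\<^sup>2 = (t - s)\<^sup>2 / \<delta>\<^sup>2"
    using False assms(4) by (auto simp: r_def power_divide)
  define N where "N = nat \<lceil>r\<rceil>"
  have N: "r \<le> real N" "real N \<le> 1 + r"
    using r(1) unfolding N_def by linarith+
  have "\<bar>t - s\<bar> \<le> real N * \<delta>"
    using N(1) assms(4) by (simp add: r_def field_simps)
  then have "\<bar>f t - f s\<bar> \<le> real N * modulus_of_continuity f \<delta>"
    by (rule modulus_of_continuity_multiple[OF assms(1-3)])
  also have "real N \<le> 1 + r\<^sup>2"
    using N(2) r(1) self_le_power[of r 2] by simp
  then have "real N * modulus_of_continuity f \<delta> \<le> (1 + r\<^sup>2) * modulus_of_continuity f \<delta>"
    using modulus_of_continuity_nonneg[OF assms(1), of \<delta>] assms(4)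
    by (intro mult_right_mono) auto
  finally show ?thesis
    by (simp add: r(2) mult.commute)
qed

subsection \<open>Monotone sublinear functionals\<close>

text \<open>Abstracts \<open>f \<mapsto> K_n f x\<close> at a fixed \<open>x\<close>. Comparison is
  demanded on [0,1] only, so \<open>L\<close> sees nothing of \<open>f\<close> outside. Translation
  by constants also encodes the normalization \<open>L 1 = 1\<close>.\<close>

locale monotone_sublinear_functional =
  fixes L :: "(real \<Rightarrow> real) \<Rightarrow> real"
  assumes mono: "\<And>f g. \<lbrakk>continuous_on {0..1} f; continuous_on {0..1} g;
      \<And>t. t \<in> {0..1} \<Longrightarrow> f t \<le> g t\<rbrakk> \<Longrightarrow> L f \<le> L g"
    and add_const: "\<And>f a. continuous_on {0..1} f \<Longrightarrow> L (\<lambda>t. f t + a) = L f + a"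
    and scale: "\<And>f a. \<lbrakk>continuous_on {0..1} f; 0 \<le> a\<rbrakk> \<Longrightarrow> L (\<lambda>t. a * f t) = a * L f"
    and subadd: "\<And>f g. \<lbrakk>continuous_on {0..1} f; continuous_on {0..1} g\<rbrakk>
      \<Longrightarrow> L (\<lambda>t. f t + g t) \<le> L f + L g"
begin

lemma const: "L (\<lambda>t. a) = a"
  using scale[of "\<lambda>t. 0" 0] add_const[of "\<lambda>t. 0" a] by simp

text \<open>\<open>L\<close> need not be odd, so the two signs are treated differently: the upper
  bound uses monotonicity and translation, while the lower one applies subadditivity to
  \<open>a \<le> f + \<bar>f - a\<bar>\<close>.\<close>

lemma deviation_le:
  assumes f: "continuous_on {0..1} f"
  shows "\<bar>L f - a\<bar> \<le> L (\<lambda>t. \<bar>f t - a\<bar>)"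
proof -
  have d: "continuous_on {0..1} (\<lambda>t. \<bar>f t - a\<bar>)"
    using f by (intro continuous_intros)
  have "L f \<le> L (\<lambda>t. \<bar>f t - a\<bar> + a)"
    using f d by (intro mono continuous_intros) auto
  also have "\<dots> = L (\<lambda>t. \<bar>f t - a\<bar>) + a"
    using d by (rule add_const)
  finally have upper: "L f - a \<le> L (\<lambda>t. \<bar>f t - a\<bar>)"
    by simp
  have "L (\<lambda>t. a) \<le> L (\<lambda>t. f t + \<bar>f t - a\<bar>)"
    using f d by (intro mono continuous_intros) auto
  also have "\<dots> \<le> L f + L (\<lambda>t. \<bar>f t - a\<bar>)"
    using f d by (rule subadd)
  finally show ?thesis
    using upper by (simp add: const)
qed

text \<open>Only nonnegative factors may be pulled out of \<open>L\<close>. Hence the cross term is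
  read as \<open>2 * x\<close> times the function \<open>-t\<close>, which is why
  \<open>L (-t)\<close> appears instead of \<open>- L t\<close>.\<close>

lemma second_moment_le:
  assumes "0 \<le> x"
  shows "L (\<lambda>t. (t - x)\<^sup>2) \<le> x\<^sup>2 + 2 * x * L (\<lambda>t. - t) + L (\<lambda>t. t\<^sup>2)"
proof -
  have "L (\<lambda>t. (t - x)\<^sup>2) = L (\<lambda>t. (2 * x * (- t) + t\<^sup>2) + x\<^sup>2)"
    by (simp add: power2_eq_square algebra_simps)
  also have "\<dots> = L (\<lambda>t. 2 * x * (- t) + t\<^sup>2) + x\<^sup>2"
    by (intro add_const continuous_intros)
  also have "L (\<lambda>t. 2 * x * (- t) + t\<^sup>2) \<le> L (\<lambda>t. 2 * x * (- t)) + L (\<lambda>t. t\<^sup>2)"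
    by (intro subadd continuous_intros)
  also have "L (\<lambda>t. 2 * x * (- t)) = 2 * x * L (\<lambda>t. - t)"
    using assms by (intro scale continuous_intros) auto
  finally show ?thesis by simp
qed

lemma second_moment_nonneg: "0 \<le> L (\<lambda>t. (t - x)\<^sup>2)"
proof -
  have "L (\<lambda>t. 0) \<le> L (\<lambda>t. (t - x)\<^sup>2)"
    by (intro mono continuous_intros) auto
  then show ?thesis by (simp add: const)
qed

lemma approximation:
  assumes f: "continuous_on {0..1} f" and x: "x \<in> {0..1}"
    and D: "L (\<lambda>t. (t - x)\<^sup>2) \<le> D"
  shows "\<bar>L f - f x\<bar> \<le> 2 * modulus_of_continuity f (sqrt D)"
proof -
  \<comment> \<open>\<open>\<delta>\<close> stays free because the choice \<open>sqrt D\<close> is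
    not positive when \<open>D = 0\<close>.\<close>
  have main: "\<bar>L f - f x\<bar> \<le> 2 * modulus_of_continuity f \<delta>" if \<delta>: "0 < \<delta>" "D \<le> \<delta>\<^sup>2" for \<delta>
  proof -
    let ?w = "modulus_of_continuity f \<delta>"
    have w: "0 \<le> ?w"
      using f \<delta> by (intro modulus_of_continuity_nonneg) auto
    have "\<bar>L f - f x\<bar> \<le> L (\<lambda>t. \<bar>f t - f x\<bar>)"
      using f by (rule deviation_le)
    also have "\<dots> \<le> L (\<lambda>t. (?w / \<delta>\<^sup>2) * (t - x)\<^sup>2 + ?w)"
    proof (rule mono)
      fix t :: real assume "t \<in> {0..1}"
      then have "\<bar>f t - f x\<bar> \<le> ?w * (1 + (t - x)\<^sup>2 / \<delta>\<^sup>2)"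
        using f x \<delta> by (intro modulus_of_continuity_quadratic)
      then show "\<bar>f t - f x\<bar> \<le> (?w / \<delta>\<^sup>2) * (t - x)\<^sup>2 + ?w"
        by (simp add: algebra_simps)
    qed (use f in \<open>intro continuous_intros; auto\<close>)+
    also have "\<dots> = L (\<lambda>t. (?w / \<delta>\<^sup>2) * (t - x)\<^sup>2) + ?w"
      by (intro add_const continuous_intros)
    also have "L (\<lambda>t. (?w / \<delta>\<^sup>2) * (t - x)\<^sup>2) = (?w / \<delta>\<^sup>2) * L (\<lambda>t. (t - x)\<^sup>2)"
      using w by (intro scale continuous_intros) auto
    also have "\<dots> \<le> (?w / \<delta>\<^sup>2) * \<delta>\<^sup>2"
      using w D \<delta> by (intro mult_left_mono) auto
    finally show ?thesis
      using \<delta>(1) by simp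
  qed
  have D0: "0 \<le> D"
    using D second_moment_nonneg[of x] by linarith
  show ?thesis
  proof (cases "D = 0")
    case False
    then show ?thesis
      using main[of "sqrt D"] D0 by simp
  next
    case True
    \<comment> \<open>For \<open>D = 0\<close> every positive \<open>\<delta>\<close> is admissible
      in \<open>main\<close>, and the modulus can be made as small as desired.\<close>
    have "\<bar>L f - f x\<bar> \<le> e" if e: "0 < e" for e
    proof -
      obtain d where "0 < d" "modulus_of_continuity f d \<le> e / 2"
        using modulus_of_continuity_small[OF f, of "e / 2"] e by auto
      then show ?thesis
        using main[of d] True by simp
    qed
    then have "\<bar>L f - f x\<bar> \<le> 0"
      using field_le_epsilon[of "\<bar>L f - f x\<bar>" 0] by simp
    also have "0 \<le> 2 * modulus_of_continuity f (sqrt D)"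
      using modulus_of_continuity_nonneg[OF f] D0 by simp
    finally show ?thesis .
  qed
qed

end

subsection \<open>The Choquet integral\<close>

lemma antimono_integrable:
  fixes \<phi> :: "real \<Rightarrow> real"
  assumes "\<And>s t. s \<le> t \<Longrightarrow> \<phi> t \<le> \<phi> s"
  shows "\<phi> integrable_on {a..b}"
proof -
  have "(\<lambda>t. - \<phi> t) integrable_on {a..b}"
    using assms by (intro integrable_on_mono_on mono_onI) auto
  then show ?thesis
    by (simp only: integrable_neg_iff)
qed

lemma antimono_unit_integral:
  fixes \<phi> :: "real \<Rightarrow> real"
  assumes "\<And>s t. s \<le> t \<Longrightarrow> \<phi> t \<le> \<phi> s"
  shows "\<phi> (a + 1) \<le> integral {a..a + 1} \<phi>" "integral {a..a + 1} \<phi> \<le> \<phi> a"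
proof -
  have I: "\<phi> integrable_on {a..a + 1}"
    using assms by (rule antimono_integrable)
  have "integral {a..a + 1} (\<lambda>t. \<phi> (a + 1)) \<le> integral {a..a + 1} \<phi>"
    using assms I by (intro integral_le) auto
  then show "\<phi> (a + 1) \<le> integral {a..a + 1} \<phi>" by simp
  have "integral {a..a + 1} \<phi> \<le> integral {a..a + 1} (\<lambda>t. \<phi> a)"
    using assms I by (intro integral_le) auto
  then show "integral {a..a + 1} \<phi> \<le> \<phi> a" by simp
qed

text \<open>The comparison behind the integral test: right endpoints give the lower sum, left
  endpoints the upper one. It links Choquet integrals to sums of capacities of integer level
  sets.\<close>

lemma antimono_integral_sum:
  fixes \<phi> :: "real \<Rightarrow> real"
  assumes \<phi>: "\<And>s t. s \<le> t \<Longrightarrow> \<phi> t \<le> \<phi> s"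
  shows "(\<Sum>i=1..M. \<phi> (real i)) \<le> integral {0..real M} \<phi>"
    and "integral {0..real M} \<phi> \<le> (\<Sum>i<M. \<phi> (real i))"
proof (induction M)
  case (Suc M)
  have split: "integral {0..real (Suc M)} \<phi>
      = integral {0..real M} \<phi> + integral {real M..real M + 1} \<phi>"
    using Henstock_Kurzweil_Integration.integral_combine[of 0 "real M" "real (Suc M)" \<phi>] antimono_integrable[of \<phi>, OF \<phi>]
    by (simp add: add.commute)
  {
    case 1
    show ?case
      using Suc.IH(1) antimono_unit_integral(1)[of \<phi> "real M", OF \<phi>] unfolding split
      by (simp add: add.commute)
  next
    case 2
    show ?case
      using Suc.IH(2) antimono_unit_integral(2)[of \<phi> "real M", OF \<phi>] unfolding split
      by simp
  }
qed simp_all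

section \<open>Submodular capacities and level sets of integer-valued functions\<close>

locale submodular_capacity =
  fixes \<Sigma> :: "real set set" and \<nu> :: "real set \<Rightarrow> real"
  assumes closed_algebra: "closed_containing_algebra \<Sigma>"
    and capacity: "capacity \<Sigma> \<nu>"
    and submod: "submodular \<Sigma> \<nu>"
begin

lemma closed_mem: "closed C \<Longrightarrow> C \<subseteq> {0..1} \<Longrightarrow> C \<in> \<Sigma>"
  using closed_algebra by (simp add: closed_containing_algebra_def)

lemma Un_mem: "A \<in> \<Sigma> \<Longrightarrow> B \<in> \<Sigma> \<Longrightarrow> A \<union> B \<in> \<Sigma>"
  and Int_mem: "A \<in> \<Sigma> \<Longrightarrow> B \<in> \<Sigma> \<Longrightarrow> A \<inter> B \<in> \<Sigma>"
  using closed_algebra algebra_iff_Un algebra_iff_Int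
  unfolding closed_containing_algebra_def by metis+

lemma nu_nonneg: "A \<in> \<Sigma> \<Longrightarrow> 0 \<le> \<nu> A"
  and nu_mono: "A \<in> \<Sigma> \<Longrightarrow> B \<in> \<Sigma> \<Longrightarrow> A \<subseteq> B \<Longrightarrow> \<nu> A \<le> \<nu> B"
  and nu_empty: "\<nu> {} = 0"
  using capacity by (auto simp: capacity_def)

lemma submodD: "A \<in> \<Sigma> \<Longrightarrow> B \<in> \<Sigma> \<Longrightarrow> \<nu> (A \<union> B) + \<nu> (A \<inter> B) \<le> \<nu> A + \<nu> B"
  using submod by (simp add: submodular_def)

text \<open>With \<open>E i\<close> the level sets of \<open>h\<close>, adding the indicator of
  \<open>B\<close> turns \<open>E (i+1)\<close> into the union of \<open>E (i+1)\<close> and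
  \<open>E i \<inter> B\<close>, and these two sets meet in \<open>E (i+1) \<inter> B\<close>.
  Submodularity at each level then telescopes in \<open>\<nu> (E i \<inter> B)\<close>, starting
  from \<open>\<nu> B\<close> at level 0.\<close>

lemma level_sum_add_indicator:
  fixes h :: "real \<Rightarrow> nat"
  assumes h: "\<And>i. {x\<in>A. i \<le> h x} \<in> \<Sigma>" and B: "B \<in> \<Sigma>" "B \<subseteq> A"
  shows "(\<Sum>i=1..k. \<nu> {x\<in>A. i \<le> h x + of_bool (x \<in> B)}) + \<nu> ({x\<in>A. k \<le> h x} \<inter> B)
    \<le> (\<Sum>i=1..k. \<nu> {x\<in>A. i \<le> h x}) + \<nu> B"
proof (induction k)
  case 0
  then show ?case using B by (simp add: Int_absorb1 Int_def[symmetric] Collect_conj_eq)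
next
  case (Suc k)
  let ?E = "\<lambda>i. {x\<in>A. i \<le> h x}"
  have "?E (Suc k) \<union> (?E k \<inter> B) = {x\<in>A. Suc k \<le> h x + of_bool (x \<in> B)}"
    using B(2) by auto
  moreover have "?E (Suc k) \<inter> (?E k \<inter> B) = ?E (Suc k) \<inter> B"
    by auto
  ultimately have "\<nu> {x\<in>A. Suc k \<le> h x + of_bool (x \<in> B)} + \<nu> (?E (Suc k) \<inter> B)
      \<le> \<nu> (?E (Suc k)) + \<nu> (?E k \<inter> B)"
    using submodD[of "?E (Suc k)" "?E k \<inter> B"] h B Int_mem by simp
  then show ?case
    using Suc.IH by simp
qed

lemma level_add_mem:
  fixes h g :: "real \<Rightarrow> nat"
  assumes h: "\<And>i. {x\<in>A. i \<le> h x} \<in> \<Sigma>" and g: "\<And>i. {x\<in>A. i \<le> g x} \<in> \<Sigma>"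
  shows "{x\<in>A. i \<le> h x + g x} \<in> \<Sigma>"
proof -
  \<comment> \<open>A sum reaches \<open>i\<close> exactly when some split \<open>a\<close>,
    \<open>i - a\<close> is reached; finitely many splits suffice, as an algebra requires. The range
    \<open>m\<close> is decoupled from \<open>i\<close> so that induction applies.\<close>
  have "(\<Union>a\<in>{..m}. {x\<in>A. a \<le> h x} \<inter> {x\<in>A. i - a \<le> g x}) \<in> \<Sigma>" for m
  proof (induction m)
    case (Suc m)
    then show ?case
      using Un_mem Int_mem h g by (simp add: atMost_Suc)
  qed (use Int_mem[OF h[of 0] g[of i]] in simp)
  moreover have "{x\<in>A. i \<le> h x + g x}
      = (\<Union>a\<in>{..i}. {x\<in>A. a \<le> h x} \<inter> {x\<in>A. i - a \<le> g x})"
  proof (intro set_eqI iffI)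
    fix x assume "x \<in> {x\<in>A. i \<le> h x + g x}"
    then show "x \<in> (\<Union>a\<in>{..i}. {x\<in>A. a \<le> h x} \<inter> {x\<in>A. i - a \<le> g x})"
      by (intro UN_I[of "min i (h x)"]) auto
  qed auto
  ultimately show ?thesis by simp
qed

text \<open>Subadditivity for integer-valued functions: \<open>g\<close> is built up one level set at a time.\<close>

lemma level_sum_subadd:
  fixes h g :: "real \<Rightarrow> nat"
  assumes h: "\<And>i. {x\<in>A. i \<le> h x} \<in> \<Sigma>" and g: "\<And>i. {x\<in>A. i \<le> g x} \<in> \<Sigma>"
  shows "(\<Sum>i=1..k. \<nu> {x\<in>A. i \<le> h x + min (g x) m})
    \<le> (\<Sum>i=1..k. \<nu> {x\<in>A. i \<le> h x}) + (\<Sum>i=1..m. \<nu> {x\<in>A. i \<le> g x})"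
proof (induction m)
  case (Suc m)
  \<comment> \<open>Raising the truncation of \<open>g\<close> from \<open>m\<close> to
    \<open>Suc m\<close> adds exactly the indicator of \<open>?B\<close>.\<close>
  let ?h = "\<lambda>x. h x + min (g x) m" and ?B = "{x\<in>A. Suc m \<le> g x}"
  have min_mem: "{x\<in>A. i \<le> min (g x) m} \<in> \<Sigma>" for i
  proof (cases "i \<le> m")
    case True
    then show ?thesis using g[of i] by simp
  next
    case False
    then show ?thesis using closed_mem[of "{}"] by simp
  qed
  have mem: "{x\<in>A. i \<le> ?h x} \<in> \<Sigma>" for i
    using h min_mem by (rule level_add_mem)
  have "{x\<in>A. i \<le> h x + min (g x) (Suc m)} = {x\<in>A. i \<le> ?h x + of_bool (x \<in> ?B)}" for i
    by auto
  then have "(\<Sum>i=1..k. \<nu> {x\<in>A. i \<le> h x + min (g x) (Suc m)})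
      = (\<Sum>i=1..k. \<nu> {x\<in>A. i \<le> ?h x + of_bool (x \<in> ?B)})"
    by simp
  also have "\<dots> \<le> (\<Sum>i=1..k. \<nu> {x\<in>A. i \<le> ?h x}) + \<nu> ?B"
    using level_sum_add_indicator[of A ?h ?B k, OF mem g]
      nu_nonneg[OF Int_mem[OF mem[of k] g[of "Suc m"]]] by auto
  finally show ?case
    using Suc.IH by simp
qed simp

end

section \<open>The Choquet integral of continuous functions over a fixed closed set\<close>

locale choquet_domain = submodular_capacity +
  fixes A :: "real set"
  assumes A_closed: "closed A" and A_unit: "A \<subseteq> {0..1}"
begin

abbreviation C :: "(real \<Rightarrow> real) \<Rightarrow> real" where
  "C \<equiv> choquet_integral \<nu> A"

abbreviation distr :: "(real \<Rightarrow> real) \<Rightarrow> real \<Rightarrow> real" where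
  "distr f t \<equiv> \<nu> {x\<in>A. t \<le> f x}"

lemma A_mem: "A \<in> \<Sigma>"
  using A_closed A_unit by (rule closed_mem)

lemma level_mem:
  fixes f :: "real \<Rightarrow> real"
  shows "continuous_on A f \<Longrightarrow> {x\<in>A. t \<le> f x} \<in> \<Sigma>"
  using A_unit
  by (intro closed_mem continuous_on_closed_Collect_le continuous_on_const A_closed) auto

lemma bounded_on_A:
  assumes "continuous_on A f"
  obtains N :: nat where "\<And>x. x \<in> A \<Longrightarrow> \<bar>f x\<bar> \<le> real N"
proof -
  have "compact A"
    using A_closed A_unit by (meson bounded_subset bounded_closed_interval compact_eq_bounded_closed)
  then have "bounded (f ` A)"
    using assms compact_continuous_image compact_imp_bounded by blast
  then obtain b where "\<And>x. x \<in> A \<Longrightarrow> \<bar>f x\<bar> \<le> b"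
    unfolding bounded_iff by auto
  then show ?thesis
    using that[of "nat \<lceil>b\<rceil>"] by (meson order_trans real_nat_ceiling_ge)
qed

lemma distr_antimono: "continuous_on A f \<Longrightarrow> s \<le> t \<Longrightarrow> distr f t \<le> distr f s"
  by (rule nu_mono[OF level_mem level_mem]) auto

lemma distr_integrable: "continuous_on A f \<Longrightarrow> distr f integrable_on {a..b}"
  by (rule antimono_integrable) (rule distr_antimono)

text \<open>Above \<open>M\<close> the level sets are empty, and below \<open>m\<close> they are all
  of \<open>A\<close>, so both half-line integrals shrink to a bounded window around 0;
  \<open>m * \<nu> A\<close> accounts for the subtracted constant. The freedom in \<open>m\<close>
  and \<open>M\<close> allows a common window for several functions.\<close>

lemma choquet_eq:
  assumes f: "continuous_on A f" and m: "m \<le> 0" "\<And>x. x \<in> A \<Longrightarrow> m \<le> f x"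
    and M: "0 \<le> M" "\<And>x. x \<in> A \<Longrightarrow> f x \<le> M"
  shows "C f = m * \<nu> A + integral {m..M} (distr f)"
proof -
  have top: "distr f t = 0" if "t > M" for t
  proof -
    have "{x\<in>A. t \<le> f x} = {}"
      using M(2) that by force
    then show ?thesis by (simp only: nu_empty)
  qed
  have bot: "distr f t = \<nu> A" if "t < m" for t
  proof -
    have "{x\<in>A. t \<le> f x} = A"
      using m(2) that by force
    then show ?thesis by simp
  qed
  have pos: "integral {0..M} (distr f) = integral {0..} (distr f)"
    by (rule integral_spike_set; rule empty_imp_negligible, use top in force)
  have "((\<lambda>t. distr f t - \<nu> A) has_integral
      (integral {m..0} (distr f) - (0 - m) * \<nu> A)) {m..0}"
    using has_integral_diff[OF integrable_integral[OF distr_integrable[OF f, of m 0]]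
        has_integral_const_real[of "\<nu> A" m 0]] m(1) by simp
  moreover have "integral {m..0} (\<lambda>t. distr f t - \<nu> A) = integral {..0} (\<lambda>t. distr f t - \<nu> A)"
    by (rule integral_spike_set; rule empty_imp_negligible, use bot in force)
  ultimately have neg: "integral {..0} (\<lambda>t. distr f t - \<nu> A) = integral {m..0} (distr f) + m * \<nu> A"
    by (simp add: integral_unique)
  have "integral {m..M} (distr f) = integral {m..0} (distr f) + integral {0..M} (distr f)"
    using Henstock_Kurzweil_Integration.integral_combine[OF m(1) M(1) distr_integrable[OF f]]
    by simp
  with pos neg show ?thesis
    by (simp add: choquet_integral_def)
qed

lemma choquet_mono:
  assumes f: "continuous_on A f" and g: "continuous_on A g"
    and le: "\<And>x. x \<in> A \<Longrightarrow> f x \<le> g x"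
  shows "C f \<le> C g"
proof -
  obtain N where N: "\<And>x. x \<in> A \<Longrightarrow> \<bar>f x\<bar> \<le> real N"
    using bounded_on_A[OF f] by auto
  obtain K where K: "\<And>x. x \<in> A \<Longrightarrow> \<bar>g x\<bar> \<le> real K"
    using bounded_on_A[OF g] by auto
  have "C f = - (real N + real K) * \<nu> A
      + integral {- (real N + real K)..real N + real K} (distr f)"
    using N by (intro choquet_eq f) (auto simp: abs_le_iff, force+)
  moreover have "C g = - (real N + real K) * \<nu> A
      + integral {- (real N + real K)..real N + real K} (distr g)"
    using K by (intro choquet_eq g) (auto simp: abs_le_iff, force+)
  moreover have "distr f t \<le> distr g t" for t
    using le f g by (intro nu_mono level_mem) (auto intro: order_trans)
  then have "integral {- (real N + real K)..real N + real K} (distr f)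
      \<le> integral {- (real N + real K)..real N + real K} (distr g)"
    using f g by (intro integral_le distr_integrable) auto
  ultimately show ?thesis by simp
qed

lemma choquet_add_const:
  assumes f: "continuous_on A f"
  shows "C (\<lambda>x. f x + a) = C f + a * \<nu> A"
proof -
  obtain N where N: "\<And>x. x \<in> A \<Longrightarrow> \<bar>f x\<bar> \<le> real N"
    using bounded_on_A[OF f] by auto
  \<comment> \<open>Large enough that the window \<open>{- R..R}\<close> still contains 0 after a
    shift by \<open>a\<close>.\<close>
  define R where "R = real N + \<bar>a\<bar>"
  have fR: "- R \<le> f x" "f x \<le> R" if "x \<in> A" for x
    using N[OF that] by (auto simp: R_def)
  have "C f = - R * \<nu> A + integral {- R..R} (distr f)"
    using fR by (intro choquet_eq f) (auto simp: R_def)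
  moreover have "C (\<lambda>x. f x + a) = (- R + a) * \<nu> A
      + integral {- R + a..R + a} (distr (\<lambda>x. f x + a))"
    using fR by (intro choquet_eq continuous_intros f) (auto simp: R_def)
  moreover have "integral {- R + a..R + a} (distr (\<lambda>x. f x + a)) = integral {- R..R} (distr f)"
  proof -
    have "distr (\<lambda>x. f x + a) = (\<lambda>t. distr f (t - a))"
      by (simp add: diff_le_eq)
    then show ?thesis
      using integral_shift_Icc_real[of "- R" R "\<lambda>t. distr f (t - a)" a]
      by (simp add: o_def add.commute)
  qed
  ultimately show ?thesis by (simp add: algebra_simps)
qed

text \<open>Substitution in the level variable: \<open>a * f\<close> reaches \<open>t\<close> where
  \<open>f\<close> reaches \<open>t / a\<close>. The division is why \<open>a\<close> is strictly
  positive here.\<close>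

lemma choquet_scale:
  assumes f: "continuous_on A f" and a: "0 < a"
  shows "C (\<lambda>x. a * f x) = a * C f"
proof -
  obtain N where N: "\<And>x. x \<in> A \<Longrightarrow> \<bar>f x\<bar> \<le> real N"
    using bounded_on_A[OF f] by auto
  have fN: "- real N \<le> f x" "f x \<le> real N" if "x \<in> A" for x
    using N[OF that] by auto
  have "C f = - real N * \<nu> A + integral {- real N..real N} (distr f)"
    using fN by (intro choquet_eq f) auto
  moreover have "C (\<lambda>x. a * f x) = (a * - real N) * \<nu> A
      + integral {a * - real N..a * real N} (distr (\<lambda>x. a * f x))"
  proof (rule choquet_eq)
    show "a * - real N \<le> a * f x" "a * f x \<le> a * real N" if "x \<in> A" for x
      using fN[OF that] a by (auto intro: mult_left_mono simp only: less_imp_le)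
  qed (use a f in \<open>auto intro: continuous_intros\<close>)
  moreover have "integral {a * - real N..a * real N} (distr (\<lambda>x. a * f x))
      = a * integral {- real N..real N} (distr f)"
  proof -
    have "((\<lambda>t. distr f (inverse a *\<^sub>R t + 0)) has_integral
        integral {- real N..real N} (distr f) /\<^sub>R inverse a ^ DIM(real))
        (cbox ((- real N - 0) /\<^sub>R inverse a) ((real N - 0) /\<^sub>R inverse a))"
      using a integrable_integral[OF distr_integrable[OF f]]
      by (intro has_integral_affinity') auto
    moreover have "distr f (inverse a *\<^sub>R t + 0) = distr (\<lambda>x. a * f x) t" for t
      using a by (simp add: field_simps)
    ultimately have "(distr (\<lambda>x. a * f x) has_integral
        a * integral {- real N..real N} (distr f)) {a * - real N..a * real N}"
      by simp
    then show ?thesis by (rule integral_unique)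
  qed
  ultimately show ?thesis
    by (simp only: distrib_left mult.assoc)
qed

lemma choquet_zero: "C (\<lambda>x. 0) = 0"
  using choquet_eq[of "\<lambda>x. 0" 0 0] by simp

text \<open>Replace \<open>f\<close> and \<open>g\<close> by their integer parts and use
  subadditivity of level sums. One \<open>\<nu> A\<close> is the level-0 term of the upper sum for
  \<open>f + g\<close>; the other comes from rounding, which lowers the level by one and so brings
  in level 0 of the rounded sum.\<close>

lemma choquet_subadd_nonneg_error:
  assumes f: "continuous_on A f" "\<And>x. x \<in> A \<Longrightarrow> 0 \<le> f x"
    and g: "continuous_on A g" "\<And>x. x \<in> A \<Longrightarrow> 0 \<le> g x"
  shows "C (\<lambda>x. f x + g x) \<le> C f + C g + 2 * \<nu> A"
proof -
  obtain N where N: "\<And>x. x \<in> A \<Longrightarrow> \<bar>f x\<bar> \<le> real N"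
    using bounded_on_A[OF f(1)] by auto
  obtain K where K: "\<And>x. x \<in> A \<Longrightarrow> \<bar>g x\<bar> \<le> real K"
    using bounded_on_A[OF g(1)] by auto
  let ?s = "\<lambda>x. f x + g x" and ?f = "\<lambda>x. nat \<lfloor>f x\<rfloor>" and ?g = "\<lambda>x. nat \<lfloor>g x\<rfloor>"
  define M where "M = Suc (N + K)"
  have s: "continuous_on A ?s"
    using f(1) g(1) by (intro continuous_intros)
  have f_lev: "{x\<in>A. i \<le> ?f x} = {x\<in>A. real i \<le> f x}" for i
    using f(2) by (auto simp: le_nat_iff le_floor_iff)
  have g_lev: "{x\<in>A. i \<le> ?g x} = {x\<in>A. real i \<le> g x}" for i
    using g(2) by (auto simp: le_nat_iff le_floor_iff)
  have f_mem: "{x\<in>A. i \<le> ?f x} \<in> \<Sigma>" and g_mem: "{x\<in>A. i \<le> ?g x} \<in> \<Sigma>" for i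
    unfolding f_lev g_lev using f(1) g(1) by (auto intro: level_mem)
  have Cf: "C f = integral {0..real M} (distr f)"
    using choquet_eq[OF f(1), of 0 "real M"] f(2) N by (force simp: M_def)
  have Cg: "C g = integral {0..real K} (distr g)"
    using choquet_eq[OF g(1), of 0 "real K"] g(2) K by force
  have Cs: "C ?s = integral {0..real (Suc M)} (distr ?s)"
    using choquet_eq[OF s, of 0 "real (Suc M)"] f(2) g(2) N K by (force simp: M_def)
  have g_min: "min (?g x) K = ?g x" if "x \<in> A" for x
    using K[OF that] by (simp add: min_def) linarith
  \<comment> \<open>Two integer parts lose strictly less than 2 together, so by integrality only one
    level is lost. The truncation at \<open>K\<close> is vacuous on \<open>A\<close> and only
    matches the form of \<open>level_sum_subadd\<close>.\<close>
  have step: "distr ?s (real (Suc i)) \<le> \<nu> {x\<in>A. i \<le> ?f x + min (?g x) K}" for i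
  proof (rule nu_mono)
    have "{x\<in>A. i \<le> ?f x + min (?g x) K} = {x\<in>A. i \<le> ?f x + ?g x}"
      using g_min by auto
    then show "{x\<in>A. i \<le> ?f x + min (?g x) K} \<in> \<Sigma>"
      using level_add_mem[OF f_mem g_mem] by simp
    show "{x\<in>A. real (Suc i) \<le> ?s x} \<subseteq> {x\<in>A. i \<le> ?f x + min (?g x) K}"
    proof clarify
      fix x assume x: "x \<in> A" "real (Suc i) \<le> ?s x"
      then have "f x < real (?f x) + 1" "g x < real (?g x) + 1"
        using f(2)[of x] g(2)[of x] by linarith+
      with x have "i \<le> ?f x + ?g x" by linarith
      then show "i \<le> ?f x + min (?g x) K"
        using g_min[OF x(1)] by simp
    qed
  qed (rule level_mem[OF s])
  have "C ?s \<le> (\<Sum>i<Suc M. distr ?s (real i))"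
    unfolding Cs by (intro antimono_integral_sum(2) distr_antimono s)
  also have "\<dots> = distr ?s 0 + (\<Sum>i<M. distr ?s (real (Suc i)))"
    by (simp only: sum.lessThan_Suc_shift of_nat_0)
  also have "distr ?s 0 \<le> \<nu> A"
    by (intro nu_mono level_mem s A_mem) auto
  also have "(\<Sum>i<M. distr ?s (real (Suc i)))
      \<le> (\<Sum>i<M. \<nu> {x\<in>A. i \<le> ?f x + min (?g x) K})"
    by (intro sum_mono step)
  \<comment> \<open>A nonnegative term at \<open>M\<close> is appended, so that splitting off level
    0 leaves the levels 1 to \<open>M\<close>.\<close>
  also have "\<dots> \<le> (\<Sum>i<Suc M. \<nu> {x\<in>A. i \<le> ?f x + min (?g x) K})"
  proof -
    have "0 \<le> distr ?s (real (Suc M))"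
      by (intro nu_nonneg level_mem s)
    then show ?thesis
      using step[of M] by simp
  qed
  also have "\<dots> = \<nu> A + (\<Sum>i=1..M. \<nu> {x\<in>A. i \<le> ?f x + min (?g x) K})"
    by (simp add: sum.lessThan_Suc_shift sum.atLeast1_atMost_eq del: sum.lessThan_Suc)
  also have "(\<Sum>i=1..M. \<nu> {x\<in>A. i \<le> ?f x + min (?g x) K})
      \<le> (\<Sum>i=1..M. \<nu> {x\<in>A. i \<le> ?f x}) + (\<Sum>i=1..K. \<nu> {x\<in>A. i \<le> ?g x})"
    by (intro level_sum_subadd f_mem g_mem)
  also have "(\<Sum>i=1..M. \<nu> {x\<in>A. i \<le> ?f x}) \<le> C f"
    unfolding f_lev Cf by (intro antimono_integral_sum(1) distr_antimono f(1))
  also have "(\<Sum>i=1..K. \<nu> {x\<in>A. i \<le> ?g x}) \<le> C g"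
    unfolding g_lev Cg by (intro antimono_integral_sum(1) distr_antimono g(1))
  finally show ?thesis by simp
qed

text \<open>Homogeneity lets one rescale by \<open>n\<close>, which shrinks the additive error to \<open>2 * \<nu> A / n\<close>.\<close>

lemma choquet_subadd_nonneg:
  assumes f: "continuous_on A f" "\<And>x. x \<in> A \<Longrightarrow> 0 \<le> f x"
    and g: "continuous_on A g" "\<And>x. x \<in> A \<Longrightarrow> 0 \<le> g x"
  shows "C (\<lambda>x. f x + g x) \<le> C f + C g"
proof (rule field_le_epsilon)
  fix e :: real assume e: "0 < e"
  \<comment> \<open>The quotient makes the error \<open>2 * \<nu> A\<close> at most
    \<open>a * e\<close>; the summand 1 keeps \<open>a\<close> positive when
    \<open>\<nu> A = 0\<close>.\<close>
  define a where "a = 2 * \<nu> A / e + 1"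
  have "0 \<le> \<nu> A"
    by (rule nu_nonneg[OF A_mem])
  then have a: "0 < a" "2 * \<nu> A \<le> a * e"
    using e by (auto simp: a_def field_simps add_nonneg_pos)
  have "a * C (\<lambda>x. f x + g x) = C (\<lambda>x. a * f x + a * g x)"
    using choquet_scale[of "\<lambda>x. f x + g x" a] f(1) g(1) a(1)
    by (simp add: continuous_on_add distrib_left)
  also have "\<dots> \<le> C (\<lambda>x. a * f x) + C (\<lambda>x. a * g x) + 2 * \<nu> A"
    using f g a(1) by (intro choquet_subadd_nonneg_error) (auto intro: continuous_intros)
  also have "\<dots> \<le> a * (C f + C g + e)"
    using a f(1) g(1) by (simp add: choquet_scale distrib_left)
  finally show "C (\<lambda>x. f x + g x) \<le> C f + C g + e"
    using a(1) by simp
qed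

text \<open>Constants make both functions nonnegative on \<open>A\<close>; translation then
  contributes the same multiple of \<open>\<nu> A\<close> to both sides.\<close>

lemma choquet_subadd:
  assumes f: "continuous_on A f" and g: "continuous_on A g"
  shows "C (\<lambda>x. f x + g x) \<le> C f + C g"
proof -
  obtain N where N: "\<And>x. x \<in> A \<Longrightarrow> \<bar>f x\<bar> \<le> real N"
    using bounded_on_A[OF f] by auto
  obtain K where K: "\<And>x. x \<in> A \<Longrightarrow> \<bar>g x\<bar> \<le> real K"
    using bounded_on_A[OF g] by auto
  have "C (\<lambda>x. (f x + real N) + (g x + real K)) \<le> C (\<lambda>x. f x + real N) + C (\<lambda>x. g x + real K)"
    using f g N K by (intro choquet_subadd_nonneg continuous_intros) (force simp: abs_le_iff)+
  moreover have "C (\<lambda>x. (f x + real N) + (g x + real K))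
      = C (\<lambda>x. f x + g x) + (real N + real K) * \<nu> A"
    using choquet_add_const[of "\<lambda>x. f x + g x" "real N + real K"] f g
    by (simp add: continuous_on_add algebra_simps)
  ultimately show ?thesis
    using f g by (simp add: choquet_add_const distrib_right)
qed

end

subsection \<open>The Bernstein-Kantorovich-Choquet operator\<close>

lemma kantorovich_interval_unit:
  assumes "k \<le> n"
  shows "kantorovich_interval n k \<subseteq> {0..1}"
  using assms by (auto simp: kantorovich_interval_def field_simps intro: order_trans)

lemma Bernstein_weights:
  shows "x \<in> {0..1} \<Longrightarrow> 0 \<le> real (n choose k) * x ^ k * (1 - x) ^ (n - k)"
    and "(\<Sum>k=0..n. real (n choose k) * x ^ k * (1 - x) ^ (n - k)) = 1"
  using binomial_ring[of x "1 - x" n] by (auto simp: atMost_atLeast0)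

text \<open>At fixed \<open>x\<close> the operator is a convex combination, with Bernstein weights,
  of Choquet integrals divided by the positive capacity of their intervals. Each quotient has the
  required properties, and convex combinations preserve them.\<close>

lemma (in submodular_capacity) bernstein_kantorovich_choquet_sublinear:
  assumes pos: "\<And>k. k \<le> n \<Longrightarrow> 0 < \<nu> (kantorovich_interval n k)" and x: "x \<in> {0..1}"
  shows "monotone_sublinear_functional (\<lambda>f. bernstein_kantorovich_choquet n \<nu> f x)"
proof -
  let ?A = "kantorovich_interval n"
  define p where "p k = real (n choose k) * x ^ k * (1 - x) ^ (n - k)" for k
  have p: "0 \<le> p k" "(\<Sum>k=0..n. p k) = 1" for k
    using Bernstein_weights x by (auto simp: p_def)
  have K: "bernstein_kantorovich_choquet n \<nu> f x
      = (\<Sum>k=0..n. choquet_integral \<nu> (?A k) f / \<nu> (?A k) * p k)" for f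
    by (simp add: bernstein_kantorovich_choquet_def p_def mult.assoc)
  have dom: "choquet_domain \<Sigma> \<nu> (?A k)" if "k \<le> n" for k
    by unfold_locales
      (use kantorovich_interval_unit[OF that] in \<open>auto simp: kantorovich_interval_def\<close>)
  have cont: "continuous_on (?A k) f" if "k \<le> n" "continuous_on {0..1} f"
    for k and f :: "real \<Rightarrow> real"
    using that kantorovich_interval_unit continuous_on_subset by blast
  show ?thesis
    unfolding K
  proof
    fix f g :: "real \<Rightarrow> real"
    assume f: "continuous_on {0..1} f" and g: "continuous_on {0..1} g"
    show "(\<Sum>k=0..n. choquet_integral \<nu> (?A k) f / \<nu> (?A k) * p k)
        \<le> (\<Sum>k=0..n. choquet_integral \<nu> (?A k) g / \<nu> (?A k) * p k)"
      if "\<And>t. t \<in> {0..1} \<Longrightarrow> f t \<le> g t"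
    proof (intro sum_mono mult_right_mono divide_right_mono p(1))
      fix k assume "k \<in> {0..n}"
      then have k: "k \<le> n" by simp
      show "choquet_integral \<nu> (?A k) f \<le> choquet_integral \<nu> (?A k) g"
        using that kantorovich_interval_unit[OF k]
        by (intro choquet_domain.choquet_mono[OF dom[OF k]] cont[OF k] f g) blast
      show "0 \<le> \<nu> (?A k)"
        using pos[OF k] by simp
    qed
    show "(\<Sum>k=0..n. choquet_integral \<nu> (?A k) (\<lambda>t. f t + g t) / \<nu> (?A k) * p k)
        \<le> (\<Sum>k=0..n. choquet_integral \<nu> (?A k) f / \<nu> (?A k) * p k)
          + (\<Sum>k=0..n. choquet_integral \<nu> (?A k) g / \<nu> (?A k) * p k)"
      unfolding sum.distrib[symmetric] distrib_right[symmetric] add_divide_distrib[symmetric]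
    proof (intro sum_mono mult_right_mono divide_right_mono p(1))
      fix k assume "k \<in> {0..n}"
      then have k: "k \<le> n" by simp
      show "choquet_integral \<nu> (?A k) (\<lambda>t. f t + g t)
          \<le> choquet_integral \<nu> (?A k) f + choquet_integral \<nu> (?A k) g"
        by (intro choquet_domain.choquet_subadd[OF dom[OF k]] cont[OF k] f g)
      show "0 \<le> \<nu> (?A k)"
        using pos[OF k] by simp
    qed
  next
    fix f :: "real \<Rightarrow> real" and a :: real
    assume f: "continuous_on {0..1} f"
    have "(\<Sum>k=0..n. choquet_integral \<nu> (?A k) (\<lambda>t. f t + a) / \<nu> (?A k) * p k)
        = (\<Sum>k=0..n. choquet_integral \<nu> (?A k) f / \<nu> (?A k) * p k + a * p k)"
    proof (rule sum.cong)
      fix k assume "k \<in> {0..n}"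
      then have k: "k \<le> n" by simp
      show "choquet_integral \<nu> (?A k) (\<lambda>t. f t + a) / \<nu> (?A k) * p k
          = choquet_integral \<nu> (?A k) f / \<nu> (?A k) * p k + a * p k"
        using pos[OF k]
        unfolding choquet_domain.choquet_add_const[OF dom[OF k] cont[OF k f]]
        by (simp add: field_simps)
    qed simp
    also have "\<dots> = (\<Sum>k=0..n. choquet_integral \<nu> (?A k) f / \<nu> (?A k) * p k) + a"
      by (simp add: sum.distrib sum_distrib_left[symmetric] p(2))
    finally show "(\<Sum>k=0..n. choquet_integral \<nu> (?A k) (\<lambda>t. f t + a) / \<nu> (?A k) * p k)
        = (\<Sum>k=0..n. choquet_integral \<nu> (?A k) f / \<nu> (?A k) * p k) + a" .
    assume a: "0 \<le> a"
    show "(\<Sum>k=0..n. choquet_integral \<nu> (?A k) (\<lambda>t. a * f t) / \<nu> (?A k) * p k)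
        = a * (\<Sum>k=0..n. choquet_integral \<nu> (?A k) f / \<nu> (?A k) * p k)"
      unfolding sum_distrib_left
    proof (rule sum.cong)
      fix k assume "k \<in> {0..n}"
      then have k: "k \<le> n" by simp
      \<comment> \<open>The factor 0 lies outside \<open>choquet_scale\<close> and is settled by
        \<open>choquet_zero\<close>.\<close>
      have "choquet_integral \<nu> (?A k) (\<lambda>t. a * f t) = a * choquet_integral \<nu> (?A k) f"
        using choquet_domain.choquet_scale[OF dom[OF k] cont[OF k f], of a]
          choquet_domain.choquet_zero[OF dom[OF k]] a by (cases "a = 0") auto
      then show "choquet_integral \<nu> (?A k) (\<lambda>t. a * f t) / \<nu> (?A k) * p k
          = a * (choquet_integral \<nu> (?A k) f / \<nu> (?A k) * p k)"
        by simp
    qed simp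
  qed
qed

theorem theorem4:
  fixes \<Sigma> :: "real set set" and \<nu> :: "real set \<Rightarrow> real" and c :: real
    and f :: "real \<Rightarrow> real" and x :: real and n :: nat
  assumes "closed_containing_algebra \<Sigma>"
    and "capacity \<Sigma> \<nu>" and "normalized \<nu>" and "submodular \<Sigma> \<nu>"
    and "c \<ge> 1" and "\<And>A. A \<in> \<Sigma> \<Longrightarrow> \<nu> A \<le> c * dual_capacity \<nu> A"
    and "\<And>m k. m \<ge> 1 \<Longrightarrow> k \<le> m \<Longrightarrow> \<nu> (kantorovich_interval m k) > 0"
    and "continuous_on {0..1} f" and "\<And>t. t \<in> {0..1} \<Longrightarrow> f t \<ge> 0"
    and "x \<in> {0..1}" and "n \<ge> 1"
  shows "\<bar>bernstein_kantorovich_choquet n \<nu> f x - f x\<bar>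
    \<le> (c + 1) * modulus_of_continuity f
        (sqrt (x\<^sup>2 + 2 * x * bernstein_kantorovich_choquet n \<nu> (\<lambda>t. - t) x
                 + bernstein_kantorovich_choquet n \<nu> (\<lambda>t. t\<^sup>2) x))"
proof -
  let ?L = "\<lambda>g. bernstein_kantorovich_choquet n \<nu> g x"
  let ?D = "x\<^sup>2 + 2 * x * ?L (\<lambda>t. - t) + ?L (\<lambda>t. t\<^sup>2)"
  interpret submodular_capacity \<Sigma> \<nu>
    using assms(1,2,4) by unfold_locales
  interpret monotone_sublinear_functional ?L
    using assms(7,10,11) by (intro bernstein_kantorovich_choquet_sublinear)
  have D: "?L (\<lambda>t. (t - x)\<^sup>2) \<le> ?D"
    using assms(10) by (intro second_moment_le) simp
  \<comment> \<open>Isabelle's \<open>sqrt\<close> is negative on negative reals, where the set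
    under \<open>Sup\<close> would be empty; hence this check.\<close>
  then have "0 \<le> ?D"
    using second_moment_nonneg[of x] by linarith
  then have w: "0 \<le> modulus_of_continuity f (sqrt ?D)"
    using assms(8) by (intro modulus_of_continuity_nonneg) auto
  have "\<bar>?L f - f x\<bar> \<le> 2 * modulus_of_continuity f (sqrt ?D)"
    using assms(8,10) D by (rule approximation)
  \<comment> \<open>\<open>c \<ge> 1\<close> gives \<open>2 \<le> c + 1\<close>, and the modulus is
    nonnegative.\<close>
  also have "\<dots> \<le> (c + 1) * modulus_of_continuity f (sqrt ?D)"
    using w assms(5) by (intro mult_right_mono) auto
  finally show ?thesis .
qed

end
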